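(* For all non-negative integers $n$ and $k$, $\mathcal A_{n,k}\in\mathbb Z$.
   Context: For non-negative integers $n,k$, define $\mathcal A_{n,k}:=\sum_{h\ge 0}B_h\binom{k+h-1}{h}{n\brack h+k}n^h$, where: $B_h$ are the Bernoulli numbers ($\frac{t}{e^t-1}=\sum_{h\ge0}B_h\frac{t^h}{h!}$, so $B_1=-\tfrac12$); ${n\brack m}$ is the unsigned Stirling number of the first kind, defined by $\sum_m{n\brack m}x^m=\prod_{j=0}^{n-1}(x+j)$ and vanishing for $m>n$; binomial coefficients $\binom{N}{h}$ for any integer $N$ are defined by $\sum_h\binom{N}{h}x^h=(1+x)^N$; and $0^0=1$. *)

theory Defs
  imports
    "HOL-Computational_Algebra.Formal_Power_Series"
    "HOL-Combinatorics.Stirling"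
begin

definition bernoulli_num :: "nat \<Rightarrow> rat" where
  "bernoulli_num h = fact h * fps_nth (fps_X / (fps_exp 1 - 1)) h"

lemma bernoulli_num_egf:
  "Abs_fps (\<lambda>h. bernoulli_num h / fact h) = fps_X / (fps_exp 1 - 1)"
  by (simp add: fps_eq_iff bernoulli_num_def)

(* The sum over all h >= 0 is cut off at h = n, beyond which the Stirling number vanishes;
   see script_A_eq_sum.  The upper entry k + h - 1 of the binomial coefficient
   is -1 for k = h = 0, hence the generalized coefficient over the rationals. *)
definition script_A :: "nat \<Rightarrow> nat \<Rightarrow> rat" where
  "script_A n k = (\<Sum>h\<le>n. bernoulli_num h * ((of_nat k + of_nat h - 1) gchoose h)
                          * of_nat (stirling n (h + k)) * of_nat n ^ h)"

lemma script_A_eq_sum: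
  assumes "finite H" and "{..n} \<subseteq> H"
  shows "script_A n k = (\<Sum>h\<in>H. bernoulli_num h * ((of_nat k + of_nat h - 1) gchoose h)
                          * of_nat (stirling n (h + k)) * of_nat n ^ h)"
  unfolding script_A_def by (rule sum.mono_neutral_left) (use assms in auto)

end

theory Submission
  imports Defs "HOL-Number_Theory.Cong" "HOL-Computational_Algebra.Polynomial"
begin

text \<open>
  For \<open>k \<ge> 1\<close>, \<open>script_A n k\<close> is the coefficient of \<open>x\<^bsup>k-1\<^esup>\<close> in \<open>L Q\<close>, where
  \<open>Q = (x + 1) \<dots> (x + n - 1)\<close>, \<open>L = L\<^sub>n\<close> and \<open>L\<^sub>c = c D / (e\<^bsup>c D\<^esup> - 1)\<close> with \<open>D = d/dx\<close>.
  It suffices that it is \<open>p\<close>-integral for every prime \<open>p\<close>. Since \<open>p\<^sup>h B\<^sub>h\<close> is \<open>p\<close>-integral,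
  \<open>L\<^sub>c\<close> preserves \<open>p\<close>-integrality whenever \<open>p\<close> divides \<open>c\<close>; this settles the case
  \<open>p dvd n\<close>. Otherwise, \<open>L\<^sub>n Q = L\<^bsub>p n\<^esub> ((\<Sum>a<p. Q(x + a n)) / p)\<close>, so it suffices that \<open>p\<close> divides
  \<open>\<Sum>a<p. Q(x + a n)\<close>, which is congruent to \<open>\<Sum>a<p. Q(x + a)\<close>. With
  \<open>F = x (x + 1) \<dots> (x + n - 1)\<close> one has \<open>n Q(x) = F(x + 1) - F(x)\<close>, so \<open>n\<close> times that sum
  telescopes to \<open>F(x + p) - F(x)\<close>, which vanishes modulo \<open>p\<close>.
\<close>

section \<open>Rationals integral at a prime\<close>

text \<open>Membership in the localization of the integers at \<open>p\<close>. Any multiplier prime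
  to \<open>p\<close> is allowed, not just the reduced denominator, so closure under sums and
  products only multiplies two witnesses.\<close>

definition p_integral :: "nat \<Rightarrow> rat \<Rightarrow> bool" where
  "p_integral p x \<longleftrightarrow> (\<exists>m::int. \<not> int p dvd m \<and> of_int m * x \<in> \<int>)"

lemma p_integral_Ints:
  assumes "prime p" "x \<in> \<int>" shows "p_integral p x"
proof -
  have "\<not> int p dvd 1" using assms(1) not_prime_1 by auto
  thus ?thesis unfolding p_integral_def using assms(2) by (intro exI[of _ 1]) auto
qed

lemma p_integral_add:
  assumes "prime p" "p_integral p x" "p_integral p y" shows "p_integral p (x + y)"
proof -
  from assms obtain a b :: int where a: "\<not> int p dvd a" "of_int a * x \<in> \<int>"
    and b: "\<not> int p dvd b" "of_int b * y \<in> \<int>" by (auto simp: p_integral_def)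
  have "\<not> int p dvd a * b" using a b assms(1) by (simp add: prime_dvd_mult_iff)
  moreover have "of_int (a * b) * (x + y) = of_int b * (of_int a * x) + of_int a * (of_int b * y)"
    by (simp add: algebra_simps)
  moreover have "\<dots> \<in> \<int>" using Ints_add[OF Ints_mult[OF Ints_of_int a(2)] Ints_mult[OF Ints_of_int b(2)]] .
  ultimately show ?thesis unfolding p_integral_def by metis
qed

lemma p_integral_mult:
  assumes "prime p" "p_integral p x" "p_integral p y" shows "p_integral p (x * y)"
proof -
  from assms obtain a b :: int where a: "\<not> int p dvd a" "of_int a * x \<in> \<int>"
    and b: "\<not> int p dvd b" "of_int b * y \<in> \<int>" by (auto simp: p_integral_def)
  have "\<not> int p dvd a * b" using a b assms(1) by (simp add: prime_dvd_mult_iff)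
  moreover have "of_int (a * b) * (x * y) = (of_int a * x) * (of_int b * y)"
    by (simp add: algebra_simps)
  moreover have "\<dots> \<in> \<int>" using a b by (intro Ints_mult[OF a(2) b(2)])
  ultimately show ?thesis unfolding p_integral_def by metis
qed

lemma p_integral_sum:
  assumes "prime p" "\<And>i. i \<in> I \<Longrightarrow> p_integral p (f i)" shows "p_integral p (\<Sum>i\<in>I. f i)"
  using assms(2)
  by (induction I rule: infinite_finite_induct)
     (auto intro: p_integral_add[OF assms(1)] p_integral_Ints[OF assms(1)])

text \<open>A prime factor of the reduced denominator would have to divide every \<open>m\<close>
  that clears the denominator.\<close>

lemma Ints_if_p_integral:
  assumes "\<And>p. prime p \<Longrightarrow> p_integral p x" shows "x \<in> \<int>"
proof -
  obtain a b where q: "quotient_of x = (a, b)" by force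
  have b: "b > 0" "coprime a b" "x = of_int a / of_int b"
    using q quotient_of_denom_pos quotient_of_coprime quotient_of_div by auto
  have "nat b = 1"
  proof (rule ccontr)
    assume "nat b \<noteq> 1"
    then obtain p where p: "prime p" "p dvd nat b" using prime_factor_nat by blast
    have pb: "int p dvd b" using p(2) b(1) by (metis int_dvd_int_iff int_nat_eq less_le)
    obtain m c :: int where m: "\<not> int p dvd m" "of_int m * x = of_int c"
      using assms[OF p(1)] by (auto simp: p_integral_def elim: Ints_cases)
    have "of_int (m * a) = (of_int (c * b) :: rat)"
      using m(2) b by (simp add: field_simps)
    hence "m * a = c * b" by (simp only: of_int_eq_iff)
    hence "b dvd m * a" by simp
    hence "b dvd m" using b(2) by (simp add: coprime_commute coprime_dvd_mult_left_iff)
    thus False using m(1) pb dvd_trans by blast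
  qed
  hence "b = 1" using b(1) by simp
  thus ?thesis using b by simp
qed

text \<open>If \<open>p^e\<close> is the exact power of \<open>p\<close> in \<open>d + 1\<close>,
  then \<open>e < 2^e \<le> p^e \<le> d + 1\<close>, so \<open>p^d\<close> absorbs it.\<close>

lemma p_integral_power_div_Suc:
  assumes "prime p" shows "p_integral p (of_nat p ^ d / of_nat (Suc d))"
proof -
  obtain m where m: "Suc d = p ^ multiplicity p (Suc d) * m" "\<not> p dvd m"
    using multiplicity_decompose'[of "Suc d" p] assms not_prime_unit by blast
  define e where "e = multiplicity p (Suc d)"
  have "e < 2 ^ e" by simp
  also have "(2::nat) ^ e \<le> p ^ e" using prime_ge_2_nat[OF assms] by (intro power_mono) auto
  also have "p ^ e \<le> Suc d" using m by (intro dvd_imp_le) (auto simp: e_def multiplicity_dvd)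
  finally have le: "e \<le> d" by simp
  have nz: "m \<noteq> 0" "p \<noteq> 0" using m(2) assms by (auto intro: Nat.gr0I)
  have "of_nat (Suc d) = (of_nat p ^ e * of_nat m :: rat)"
    using m(1) unfolding e_def by (metis of_nat_mult of_nat_power)
  hence "of_int (int m) * (of_nat p ^ d / of_nat (Suc d)) = (of_nat p ^ (d - e) :: rat)"
    using nz le by (simp add: power_diff del: of_nat_Suc)
  moreover have "\<not> int p dvd int m" using m(2) by simp
  ultimately show ?thesis unfolding p_integral_def by (metis Ints_of_nat of_nat_power)
qed

section \<open>Bernoulli numbers\<close>

text \<open>The divisor has constant term 0 and is not a unit, so cancelling needs divisibility;
  this follows by comparing subdegrees.\<close>

lemma bernoulli_fps_mult:
  "(fps_X / (fps_exp 1 - 1)) * (fps_exp 1 - 1) = (fps_X :: rat fps)"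
proof -
  have nz: "fps_exp 1 - 1 \<noteq> (0 :: rat fps)"
  proof
    assume "fps_exp 1 - 1 = (0 :: rat fps)"
    hence "fps_nth (fps_exp 1 - 1 :: rat fps) 1 = 0" by simp
    thus False by simp
  qed
  have "subdegree (fps_exp 1 - 1 :: rat fps) \<le> 1" by (intro subdegree_leI) simp
  hence "(fps_exp 1 - 1 :: rat fps) dvd fps_X" using nz by (subst fps_dvd_iff) auto
  thus ?thesis by simp
qed

lemma bernoulli_num_recurrence:
  assumes "h > 0"
  shows "bernoulli_num h = - (\<Sum>j<h. of_nat (h choose j) * bernoulli_num j / of_nat (Suc (h - j)))"
proof -
  have "0 = fps_nth (fps_X :: rat fps) (Suc h)" using assms by simp
  also have "\<dots> = fps_nth (Abs_fps (\<lambda>h. bernoulli_num h / fact h) * (fps_exp 1 - 1)) (Suc h)"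
    by (simp only: bernoulli_num_egf bernoulli_fps_mult)
  \<comment> \<open>The term \<open>j = Suc h\<close> is split off; it meets the zero constant term
    of \<open>fps_exp 1 - 1\<close>.\<close>
  also have "\<dots> = (\<Sum>j\<le>h. bernoulli_num j / fact j / fact (Suc (h - j)))"
    unfolding fps_mult_nth atLeast0AtMost sum.atMost_Suc
    by (simp add: Suc_diff_le del: fact_Suc)
  finally have "0 = fact h * (\<Sum>j\<le>h. bernoulli_num j / fact j / fact (Suc (h - j)))" by simp
  also have "\<dots> = (\<Sum>j\<le>h. of_nat (h choose j) * bernoulli_num j / of_nat (Suc (h - j)))"
    unfolding sum_distrib_left by (intro sum.cong) (auto simp: binomial_fact field_simps)
  \<comment> \<open>The term \<open>j = h\<close> is \<open>bernoulli_num h\<close> itself.\<close>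
  finally show ?thesis by (simp add: lessThan_Suc_atMost[symmetric])
qed

lemma bernoulli_num_0: "bernoulli_num 0 = 1"
proof -
  have "1 = fps_nth (Abs_fps (\<lambda>h. bernoulli_num h / fact h) * (fps_exp 1 - 1)) 1"
    by (simp only: bernoulli_num_egf bernoulli_fps_mult) simp
  thus ?thesis by (simp add: fps_mult_nth)
qed

text \<open>Strong induction on the recurrence, with \<open>p^h\<close> split as
  \<open>p^(h-j) * p^j\<close>: the first factor pays for the denominator \<open>h - j + 1\<close>,
  the second for \<open>bernoulli_num j\<close>.\<close>

lemma p_integral_power_times_bernoulli:
  assumes p: "prime p" shows "p_integral p (of_nat p ^ h * bernoulli_num h)"
proof (induction h rule: less_induct)
  case (less h)
  show ?case
  proof (cases "h = 0")
    case True thus ?thesis using p by (simp add: bernoulli_num_0 p_integral_Ints)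
  next
    case False
    have "of_nat p ^ h * bernoulli_num h = (\<Sum>j<h. - of_nat (h choose j) *
        (of_nat p ^ (h - j) / of_nat (Suc (h - j))) * (of_nat p ^ j * bernoulli_num j))"
      using False
      by (subst bernoulli_num_recurrence)
         (auto simp: sum_distrib_left sum_negf[symmetric] power_add[symmetric] simp del: of_nat_Suc
            intro!: sum.cong)
    also have "p_integral p \<dots>"
      by (intro p_integral_sum p_integral_mult p p_integral_power_div_Suc less.IH)
         (auto intro: p_integral_Ints p)
    finally show ?thesis .
  qed
qed

text \<open>Coefficient comparison in
  \<open>p \<cdot> t / (e\<^sup>t - 1) = (p t / (e\<^bsup>p t\<^esup> - 1)) \<cdot> (\<Sum>a<p. e\<^bsup>a t\<^esup>)\<close>.\<close>

lemma bernoulli_num_multiplication: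
  assumes "p > 0"
  shows "of_nat p * bernoulli_num m =
    (\<Sum>h\<le>m. of_nat (m choose h) * (of_nat p ^ h * bernoulli_num h) * (\<Sum>a<p. of_nat a ^ (m - h)))"
proof -
  define G :: "rat fps" where "G = fps_X / (fps_exp 1 - 1)"
  define H :: "rat fps" where "H = G oo (fps_const (of_nat p) * fps_X)"
  define S :: "rat fps" where "S = (\<Sum>a<p. fps_exp (of_nat a))"
  have G: "G * (fps_exp 1 - 1) = fps_X" unfolding G_def by (rule bernoulli_fps_mult)
  have "(G * (fps_exp 1 - 1)) oo (fps_const (of_nat p) * fps_X) = fps_const (of_nat p) * fps_X"
    unfolding G by simp
  hence H: "H * (fps_exp (of_nat p) - 1) = fps_const (of_nat p) * fps_X"
    by (simp add: H_def fps_compose_mult_distrib fps_compose_sub_distrib)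
  \<comment> \<open>Geometric sum in \<open>fps_exp 1\<close>.\<close>
  have "fps_exp (of_nat p) - 1 = (fps_exp 1 - 1 :: rat fps) * S"
    using power_diff_1_eq[of "fps_exp (1::rat)" p] by (simp add: S_def fps_exp_power_mult)
  hence "(H * S) * (fps_exp 1 - 1) = fps_const (of_nat p) * G * (fps_exp 1 - 1)"
    using H G by (simp add: mult_ac)
  moreover have "fps_exp 1 - 1 \<noteq> (0 :: rat fps)" using G by auto
  ultimately have *: "fps_const (of_nat p) * G = H * S" by simp
  have Gn: "fps_nth G i = bernoulli_num i / fact i" for i
    by (simp add: G_def bernoulli_num_def)
  have "of_nat p * bernoulli_num m = fact m * fps_nth (fps_const (of_nat p) * G) m"
    by (simp add: Gn)
  also have "\<dots> = (\<Sum>h\<le>m. fact m * (of_nat p ^ h * (bernoulli_num h / fact h) *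
      (\<Sum>a<p. of_nat a ^ (m - h) / fact (m - h))))"
    unfolding * fps_mult_nth atLeast0AtMost sum_distrib_left[of "fact m"]
    by (simp add: H_def fps_compose_linear Gn S_def fps_sum_nth)
  also have "\<dots> = (\<Sum>h\<le>m. of_nat (m choose h) * (of_nat p ^ h * bernoulli_num h) *
      (\<Sum>a<p. of_nat a ^ (m - h)))"
    unfolding sum_divide_distrib[symmetric]
    by (intro sum.cong) (auto simp: binomial_fact field_simps)
  finally show ?thesis .
qed

section \<open>Shifted polynomials and Stirling numbers\<close>

lemma coeff_pcompose_shift:
  fixes f :: "'a :: comm_ring_1 poly"
  assumes "degree f \<le> N"
  shows "coeff (f \<circ>\<^sub>p [:c, 1:]) j = (\<Sum>i\<le>N. of_nat (j + i choose i) * c ^ i * coeff f (j + i))"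
proof -
  have pow: "([:0, 1:] ^ m) \<circ>\<^sub>p [:c, 1:] = [:c, 1:] ^ m" for m
    by (induction m)
       (simp_all only: power.simps pcompose_1 pcompose_mult, simp add: pcompose_pCons)
  \<comment> \<open>The generous bound \<open>N + j\<close> lets \<open>m = j + i\<close> range over
    exactly \<open>i \<le> N\<close> after reindexing.\<close>
  have "(\<Sum>m\<le>N+j. smult (coeff f m) ([:0, 1:] ^ m)) = f"
    using poly_as_sum_of_monoms'[of f "N + j"] assms by (simp add: monom_altdef)
  hence "f \<circ>\<^sub>p [:c, 1:] = (\<Sum>m\<le>N+j. smult (coeff f m) ([:0, 1:] ^ m)) \<circ>\<^sub>p [:c, 1:]"
    by (rule arg_cong[OF sym])
  also have "\<dots> = (\<Sum>m\<le>N+j. smult (coeff f m) ([:c, 1:] ^ m))"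
    by (simp only: pcompose_sum pcompose_smult pow)
  finally have "f \<circ>\<^sub>p [:c, 1:] = (\<Sum>m\<le>N+j. smult (coeff f m) ([:c, 1:] ^ m))" .
  hence "coeff (f \<circ>\<^sub>p [:c, 1:]) j = (\<Sum>m\<le>N+j. coeff f m * coeff ([:c, 1:] ^ m) j)"
    by (simp add: coeff_sum)
  also have "\<dots> = (\<Sum>m\<in>{j..N+j}. coeff f m * coeff ([:c, 1:] ^ m) j)"
    by (rule sum.mono_neutral_right)
       (auto simp: coeff_eq_0 degree_linear_power)
  also have "\<dots> = (\<Sum>m\<in>{j..N+j}. of_nat (m choose (m - j)) * c ^ (m - j) * coeff f m)"
    by (intro sum.cong) (auto simp: coeff_linear_poly_power mult_ac binomial_symmetric[symmetric])
  also have "\<dots> = (\<Sum>i\<le>N. of_nat (j + i choose i) * c ^ i * coeff f (j + i))"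
    by (intro sum.reindex_bij_witness[of _ "\<lambda>i. j + i" "\<lambda>m. m - j"]) auto
  finally show ?thesis .
qed

lemma coeff_pochhammer:
  "coeff (pochhammer [:0, 1:] n :: int poly) j = int (stirling n j)"
proof -
  have "pochhammer [:0, 1:] n = (\<Sum>k\<le>n. monom (int (stirling n k)) k)"
    by (subst stirling_pochhammer[symmetric])
       (auto simp: monom_altdef of_nat_poly intro!: sum.cong)
  thus ?thesis by (auto simp: coeff_sum)
qed

lemma pcompose_pochhammer:
  "pochhammer q n \<circ>\<^sub>p r = pochhammer (q \<circ>\<^sub>p r) n" for q r :: "int poly"
  by (induction n) (auto simp: pochhammer_Suc pcompose_mult pcompose_add pcompose_1 pcompose_const of_nat_poly)

text \<open>Multiplication by \<open>n\<close> permutes the residues modulo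
  \<open>p\<close>.\<close>

lemma sum_residues_mult:
  fixes p n i :: nat
  assumes "prime p" "\<not> p dvd n"
  shows "[(\<Sum>a<p. (int a * int n) ^ i) = (\<Sum>a<p. int a ^ i)] (mod int p)"
proof -
  have p: "p > 0" using assms prime_gt_0_nat by blast
  have cop: "coprime n p" using assms by (metis coprime_commute prime_imp_coprime)
  have inj: "inj_on (\<lambda>a. a * n mod p) {..<p}"
  proof (rule inj_onI)
    fix a b assume "a \<in> {..<p}" "b \<in> {..<p}" "a * n mod p = b * n mod p"
    hence "[a = b] (mod p)" using cop by (simp add: cong_def[symmetric] cong_mult_rcancel_nat)
    thus "a = b" using \<open>a \<in> _\<close> \<open>b \<in> _\<close> by (simp add: cong_less_modulus_unique_nat)
  qed
  have img: "(\<lambda>a. a * n mod p) ` {..<p} = {..<p}"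
    by (rule endo_inj_surj) (use inj p in auto)
  have "(\<Sum>a<p. int a ^ i) = (\<Sum>a<p. int (a * n mod p) ^ i)"
    by (subst img[symmetric], subst sum.reindex[OF inj]) simp
  moreover have "[(\<Sum>a<p. (int a * int n) ^ i) = (\<Sum>a<p. int (a * n mod p) ^ i)] (mod int p)"
    by (intro cong_sum cong_pow) (simp add: zmod_int cong_def)
  ultimately show ?thesis by simp
qed

text \<open>The sum is the \<open>j\<close>-th coefficient of \<open>\<Sum>a<p. Q(x + a n)\<close>.\<close>

lemma prime_dvd_stirling_shift_sum:
  assumes p: "prime p" and n: "\<not> p dvd n"
  shows "int p dvd (\<Sum>i\<le>n. int (j + i choose i) * int (stirling n (Suc (j + i))) *
           (\<Sum>a<p. (int a * int n) ^ i))"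
proof -
  \<comment> \<open>\<open>n = 0\<close> is excluded because \<open>p\<close> divides 0.\<close>
  obtain m where m: "n = Suc m" using n by (cases n) auto
  define F :: "int poly" where "F = pochhammer [:0, 1:] n"
  define Q :: "int poly" where "Q = pochhammer [:1, 1:] m"
  have FQ: "F = [:0, 1:] * Q"
    by (simp add: F_def Q_def m pochhammer_rec one_pCons)
  have cQ: "coeff Q i = int (stirling n (Suc i))" for i
  proof -
    have "coeff Q i = coeff F (Suc i)" by (simp add: FQ)
    thus ?thesis by (simp add: F_def coeff_pochhammer)
  qed
  have dQ: "degree Q \<le> n" by (rule degree_le) (auto simp: cQ)
  have dF: "degree F \<le> n" by (rule degree_le) (auto simp: F_def coeff_pochhammer)
  \<comment> \<open>Both \<open>F(x + 1) = Q (x + n)\<close> and \<open>F = x Q\<close> contain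
    \<open>Q\<close>, so their difference is \<open>n Q\<close>.\<close>
  have "F \<circ>\<^sub>p [:1, 1:] = Q * ([:1, 1:] + of_nat m)"
    unfolding F_def Q_def pcompose_pochhammer m by (simp add: pochhammer_Suc pcompose_pCons)
  hence diff: "F \<circ>\<^sub>p [:1, 1:] - F = smult (int n) Q"
    by (simp add: FQ m of_nat_poly algebra_simps)
  have step: "smult (int n) (Q \<circ>\<^sub>p [:int a, 1:]) = F \<circ>\<^sub>p [:int (Suc a), 1:] - F \<circ>\<^sub>p [:int a, 1:]" for a
  proof -
    have "[:1, 1:] \<circ>\<^sub>p [:int a, 1:] = [:int (Suc a), 1:]" by (simp add: pcompose_pCons)
    thus ?thesis using arg_cong[OF diff, of "\<lambda>f. f \<circ>\<^sub>p [:int a, 1:]"]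
      by (simp add: pcompose_diff pcompose_smult pcompose_assoc[symmetric])
  qed
  \<comment> \<open>Shifts by \<open>a\<close> instead of \<open>a * n\<close>, so that the sum
    telescopes; \<open>sum_residues_mult\<close> restores the factor \<open>n\<close> at the
    end.\<close>
  define T where "T = (\<Sum>a<p. coeff (Q \<circ>\<^sub>p [:int a, 1:]) j)"
  have "int n * T = (\<Sum>a<p. coeff (smult (int n) (Q \<circ>\<^sub>p [:int a, 1:])) j)"
    by (simp add: T_def sum_distrib_left)
  also have "\<dots> = (\<Sum>a<p. coeff (F \<circ>\<^sub>p [:int (Suc a), 1:]) j - coeff (F \<circ>\<^sub>p [:int a, 1:]) j)"
    by (simp only: step coeff_diff)
  also have "\<dots> = coeff (F \<circ>\<^sub>p [:int p, 1:]) j - coeff (F \<circ>\<^sub>p [:0, 1:]) j"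
    by (subst sum_lessThan_telescope) simp
  also have "\<dots> = (\<Sum>i\<le>n. int (j + i choose i) * (int p ^ i - 0 ^ i) * coeff F (j + i))"
    by (simp only: coeff_pcompose_shift[OF dF] sum_subtractf[symmetric] algebra_simps)
  finally have eq: "int n * T = (\<Sum>i\<le>n. int (j + i choose i) * (int p ^ i - 0 ^ i) * coeff F (j + i))" .
  \<comment> \<open>The unshifted \<open>F\<close> contributes \<open>0 ^ i\<close>; since
    \<open>0 ^ 0 = 1\<close>, it cancels the one power of \<open>p\<close> that is not a multiple of
    \<open>p\<close>.\<close>
  have pw: "int p dvd int p ^ i - 0 ^ i" for i by (cases i) auto
  have "int p dvd int n * T"
    unfolding eq by (intro dvd_sum dvd_mult2 dvd_mult pw)
  hence "int p dvd T" using p n by (simp add: prime_dvd_mult_iff)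
  moreover have "T = (\<Sum>i\<le>n. int (j + i choose i) * int (stirling n (Suc (j + i))) *
      (\<Sum>a<p. int a ^ i))"
    unfolding T_def coeff_pcompose_shift[OF dQ] cQ
    by (subst sum.swap) (simp add: sum_distrib_left mult_ac)
  moreover have "[(\<Sum>i\<le>n. int (j + i choose i) * int (stirling n (Suc (j + i))) *
           (\<Sum>a<p. (int a * int n) ^ i)) =
      (\<Sum>i\<le>n. int (j + i choose i) * int (stirling n (Suc (j + i))) * (\<Sum>a<p. int a ^ i))] (mod int p)"
    by (intro cong_sum cong_mult cong_refl sum_residues_mult p n)
  ultimately show ?thesis by (simp only: cong_dvd_iff)
qed

section \<open>Integrality of \<open>script_A\<close>\<close>

text \<open>Both sides are the trinomial coefficient \<open>(k+h+i)! / (k! h! i!)\<close>.\<close>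

lemma choose_mult_choose_add:
  "(k + h + i choose i) * (k + h choose h) = (k + (h + i) choose (h + i)) * (h + i choose h)"
proof -
  have "(of_nat ((k + h + i choose i) * (k + h choose h)) :: rat) =
        of_nat ((k + (h + i) choose (h + i)) * (h + i choose h))"
    by (simp add: binomial_fact add_ac)
  thus ?thesis by (simp only: of_nat_eq_iff)
qed

text \<open>For \<open>h > 0\<close> the upper entry \<open>h - 1\<close> is a natural number below
  \<open>h\<close>, so only \<open>h = 0\<close> survives.\<close>

lemma script_A_0: "script_A n 0 = of_nat (stirling n 0)"
proof -
  have "((of_nat h - 1 :: rat) gchoose h) = 0" if "h > 0" for h
    using that binomial_gbinomial[of "h - 1" h, where ?'a = rat]
    by (simp add: of_nat_diff binomial_eq_0)
  hence "script_A n 0 = (\<Sum>h\<in>{0}. bernoulli_num h * ((of_nat h - 1) gchoose h)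
      * of_nat (stirling n h) * of_nat n ^ h)"
    unfolding script_A_def by (intro sum.mono_neutral_cong_right) auto
  thus ?thesis by (simp add: bernoulli_num_0)
qed

text \<open>The form of a coefficient of \<open>x^k\<close> after applying \<open>L\<close>: the
  operator \<open>D^h / h!\<close> sends \<open>x^(k+h)\<close> to
  \<open>(k + h choose h) x^k\<close>.\<close>

lemma script_A_Suc:
  "script_A n (Suc k) = (\<Sum>h\<le>n. of_nat n ^ h * bernoulli_num h *
     of_nat ((k + h choose h) * stirling n (Suc (k + h))))"
  unfolding script_A_def
proof (intro sum.cong refl)
  fix h
  have "(of_nat (Suc k) + of_nat h - 1 :: rat) gchoose h = of_nat (k + h choose h)"
    by (simp add: binomial_gbinomial)
  thus "bernoulli_num h * ((of_nat (Suc k) + of_nat h - 1) gchoose h) *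
      of_nat (stirling n (h + Suc k)) * of_nat n ^ h =
      of_nat n ^ h * bernoulli_num h * of_nat ((k + h choose h) * stirling n (Suc (k + h)))"
    by (simp add: add_ac)
qed

text \<open>Coefficient form of passing from step \<open>n\<close> to step \<open>p n\<close>: the
  multiplication formula is inserted for each \<open>bernoulli_num m\<close>, and the double sum is
  regrouped by \<open>m = h + i\<close>.\<close>

lemma script_A_Suc_shift:
  assumes "p > 0"
  shows "of_nat p * script_A n (Suc k) =
    (\<Sum>h\<le>n. of_nat (k + h choose h) * of_nat n ^ h * (of_nat p ^ h * bernoulli_num h) *
       of_int (\<Sum>i\<le>n. int (k + h + i choose i) * int (stirling n (Suc (k + h + i))) *
           (\<Sum>a<p. (int a * int n) ^ i)))"
proof -
  define g :: "nat \<Rightarrow> nat \<Rightarrow> rat" where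
    "g h i = of_nat (k + h choose h) * of_nat n ^ h * (of_nat p ^ h * bernoulli_num h) *
       of_int (int (k + h + i choose i) * int (stirling n (Suc (k + h + i))) *
           (\<Sum>a<p. (int a * int n) ^ i))" for h i
  \<comment> \<open>The Stirling number vanishes here, which later allows the triangle
    \<open>h + i \<le> n\<close> to be enlarged to a square.\<close>
  have g_eq_0: "g h i = 0" if "\<not> h + i \<le> n" for h i
    using that by (simp add: g_def)
  have "of_nat p * (of_nat n ^ m * bernoulli_num m *
      of_nat ((k + m choose m) * stirling n (Suc (k + m)))) = (\<Sum>h\<le>m. g h (m - h))" for m
  proof -
    have "of_nat p * (of_nat n ^ m * bernoulli_num m *
        of_nat ((k + m choose m) * stirling n (Suc (k + m)))) =
      of_nat n ^ m * of_nat ((k + m choose m) * stirling n (Suc (k + m))) *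
        (of_nat p * bernoulli_num m)" by simp
    also have "\<dots> = (\<Sum>h\<le>m. g h (m - h))"
      unfolding bernoulli_num_multiplication[OF assms]
    proof (subst sum_distrib_left, intro sum.cong refl)
      fix h assume "h \<in> {..m}"
      then obtain i where i: "m = h + i" using le_Suc_ex by auto
      have *: "(of_nat (k + h + i choose i) :: rat) * of_nat (k + h choose h) =
          of_nat (k + (h + i) choose (h + i)) * of_nat (h + i choose h)"
        using choose_mult_choose_add[of k h i] by (metis of_nat_mult)
      have "g h i = (of_nat (k + h + i choose i) * of_nat (k + h choose h)) * of_nat n ^ (h + i) *
          (of_nat p ^ h * bernoulli_num h) * of_nat (stirling n (Suc (k + (h + i)))) *
          (\<Sum>a<p. of_nat a ^ i)"
        by (simp add: g_def power_mult_distrib sum_distrib_right[symmetric] power_add add_ac mult_ac)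
      thus "of_nat n ^ m * of_nat ((k + m choose m) * stirling n (Suc (k + m))) *
          (of_nat (m choose h) * (of_nat p ^ h * bernoulli_num h) * (\<Sum>a<p. of_nat a ^ (m - h))) =
          g h (m - h)"
        unfolding * i by (simp add: mult_ac)
    qed
    finally show ?thesis .
  qed
  hence "of_nat p * script_A n (Suc k) = (\<Sum>m\<le>n. \<Sum>h\<le>m. g h (m - h))"
    unfolding script_A_Suc by (simp add: sum_distrib_left del: of_nat_mult)
  also have "\<dots> = (\<Sum>(h, i)\<in>{(h, i). h + i \<le> n}. g h i)"
    by (rule sum.triangle_reindex_eq[symmetric])
  also have "\<dots> = (\<Sum>(h, i)\<in>{..n} \<times> {..n}. g h i)"
    by (rule sum.mono_neutral_left) (use g_eq_0 in \<open>force+\<close>)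
  also have "\<dots> = (\<Sum>h\<le>n. \<Sum>i\<le>n. g h i)"
    by (rule sum.cartesian_product[symmetric])
  finally show ?thesis unfolding g_def of_int_sum sum_distrib_left[symmetric] .
qed

lemma p_integral_script_A_Suc:
  assumes p: "prime p" shows "p_integral p (script_A n (Suc k))"
proof (cases "p dvd n")
  case True
  then obtain c where c: "n = p * c" by auto
  \<comment> \<open>The factor \<open>n^h\<close> itself supplies the \<open>p^h\<close> that makes
    \<open>bernoulli_num h\<close> integral at \<open>p\<close>.\<close>
  have "script_A n (Suc k) = (\<Sum>h\<le>n. (of_nat p ^ h * bernoulli_num h) *
     of_nat (c ^ h * ((k + h choose h) * stirling n (Suc (k + h)))))"
    unfolding script_A_Suc by (intro sum.cong) (auto simp: c power_mult_distrib)
  also have "p_integral p \<dots>"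
    by (intro p_integral_sum p_integral_mult p p_integral_power_times_bernoulli
          p_integral_Ints Ints_of_nat)
  finally show ?thesis .
next
  case False
  \<comment> \<open>The quotients form one function of \<open>j\<close>, because
    \<open>j = k + h\<close> varies with the outer index; the common factor \<open>p\<close> can
    then be cancelled.\<close>
  have "\<exists>t. \<forall>j. (\<Sum>i\<le>n. int (j + i choose i) * int (stirling n (Suc (j + i))) *
           (\<Sum>a<p. (int a * int n) ^ i)) = int p * t j"
    using prime_dvd_stirling_shift_sum[OF p False] unfolding dvd_def by metis
  then obtain t where t: "\<And>j. (\<Sum>i\<le>n. int (j + i choose i) * int (stirling n (Suc (j + i))) *
           (\<Sum>a<p. (int a * int n) ^ i)) = int p * t j" by blast
  have p0: "p > 0" using p prime_gt_0_nat by blast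
  have "of_nat p * script_A n (Suc k) = of_nat p * (\<Sum>h\<le>n. of_nat (k + h choose h) * of_nat n ^ h *
      (of_nat p ^ h * bernoulli_num h) * of_int (t (k + h)))"
    unfolding script_A_Suc_shift[OF p0] t by (simp add: sum_distrib_left mult_ac)
  hence "script_A n (Suc k) = (\<Sum>h\<le>n. of_nat (k + h choose h) * of_nat n ^ h *
      (of_nat p ^ h * bernoulli_num h) * of_int (t (k + h)))"
    using p0 by simp
  also have "p_integral p \<dots>"
    by (intro p_integral_sum p_integral_mult[OF p] p p_integral_power_times_bernoulli)
       (auto intro: p_integral_Ints p)
  finally show ?thesis .
qed

theorem theorem5p2:
  fixes n k :: nat
  shows "script_A n k \<in> \<int>"
proof (cases k)
  case 0
  thus ?thesis by (simp add: script_A_0)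
next
  case (Suc k')
  thus ?thesis by (auto intro: Ints_if_p_integral p_integral_script_A_Suc)
qed

end
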